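(* Let $C = 2\pi\sqrt{2/3}$. Then for all sufficiently large real $x$, $$\#\mathscr{F}(x) \leq \exp\left( C\sqrt{\frac{\log x}{\log\log x}}\left(1 + O\left(\frac{\log\log\log x}{\log\log x}\right)\right)\right),$$ where the implied constant is absolute. That is, there exist absolute constants $K>0$ and $x_0$ such that for all $x \ge x_0$, $\#\mathscr{F}(x) \le \exp\left( C\sqrt{\frac{\log x}{\log\log x}}\left(1 + K\,\frac{\log\log\log x}{\log\log x}\right)\right)$.
   Context: For a positive integer $n$, $f(n)$ denotes the number of unordered factorizations of $n$ into factors larger than $1$, i.e. the number of tuples $(n_1,\dots,n_r)$ of integers (of any length $r$) with $1<n_1\le n_2\le\dots\le n_r$ and $n=n_1n_2\cdots n_r$. (The empty factorization is counted for $n=1$, so $f(1)=1$.) For real $x\ge 1$, $\mathscr{F}(x)=\{f(n) : n \text{ a positive integer},\ f(n)\le x\}$ is the set of distinct values of $f$ not exceeding $x$, and $\#$ denotes cardinality. $\log$ is the natural logarithm. *)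

theory Defs
  imports Complex_Main
begin

definition unordered_factorizations :: "nat \<Rightarrow> nat list set" where
  "unordered_factorizations n =
     {ns. sorted ns \<and> (\<forall>k \<in> set ns. 1 < k) \<and> prod_list ns = n}"

definition num_unordered_factorizations :: "nat \<Rightarrow> nat" where
  "num_unordered_factorizations n = card (unordered_factorizations n)"

definition factorization_count_values :: "real \<Rightarrow> nat set" where
  "factorization_count_values x =
     {num_unordered_factorizations n | n. 0 < n \<and> real (num_unordered_factorizations n) \<le> x}"

text \<open>The sets whose cardinalities are taken are finite, so \<open>card\<close> is the true
  number of elements.\<close>

lemma length_and_factors_le_prod_list:
  fixes ns :: "nat list"
  assumes "\<forall>k \<in> set ns. 1 < k"
  shows "length ns < prod_list ns \<and> (\<forall>k \<in> set ns. k \<le> prod_list ns)"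
  using assms
proof (induction ns)
  case Nil
  then show ?case by simp
next
  case (Cons a ns)
  then have a: "2 \<le> a" and len: "length ns < prod_list ns"
    and le: "\<forall>k \<in> set ns. k \<le> prod_list ns" by auto
  define p where "p = prod_list ns"
  have "2 * p \<le> a * p" using a by (rule mult_le_mono1)
  moreover have "a * 1 \<le> a * p" using len by (intro mult_le_mono2) (simp add: p_def)
  moreover define q where "q = a * p"
  ultimately have "2 * p \<le> q" "a \<le> q" by simp_all
  then have "Suc (length ns) < q" and "\<forall>k \<in> set ns. k \<le> q"
    using len le unfolding p_def by fastforce+
  with \<open>a \<le> q\<close> show ?case by (simp add: q_def p_def)
qed

lemma finite_unordered_factorizations: "finite (unordered_factorizations n)"
proof (rule finite_subset)
  show "unordered_factorizations n \<subseteq> {ns. set ns \<subseteq> {..n} \<and> length ns \<le> n}"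
    using length_and_factors_le_prod_list by (force simp: unordered_factorizations_def)
  show "finite {ns. set ns \<subseteq> {..n} \<and> length ns \<le> n}"
    by (rule finite_lists_length_le) simp
qed

lemma num_unordered_factorizations_1: "num_unordered_factorizations 1 = 1"
proof -
  have "ns = []" if "\<forall>k \<in> set ns. 1 < k" "prod_list ns = 1" for ns :: "nat list"
    using length_and_factors_le_prod_list[OF that(1)] that(2) by simp
  then have "unordered_factorizations 1 = {[]}"
    by (auto simp: unordered_factorizations_def)
  then show ?thesis by (simp add: num_unordered_factorizations_def)
qed

lemma finite_factorization_count_values: "finite (factorization_count_values x)"
proof (rule finite_subset)
  show "factorization_count_values x \<subseteq> {.. nat \<lfloor>x\<rfloor>}"
    by (auto simp: factorization_count_values_def le_nat_floor)
qed simp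

end

theory Submission
  imports Defs
    "HOL-Computational_Algebra.Primes"
    "HOL-Combinatorics.Multiset_Permutations"
    "HOL-Analysis.Analysis"
    "HOL-Real_Asymp.Real_Asymp"
begin

text \<open>
  The value \<open>f(n)\<close> depends only on the multiset \<open>E\<close> of exponents in the prime factorization
  of \<open>n\<close>, so it suffices to count the multisets \<open>E\<close> that are compatible with \<open>f(n) \<le> x\<close>.
  The number of ordered \<open>r\<close>-tuples with product \<open>n\<close> is the product of the binomials
  \<open>C(a + r - 1, a)\<close> over \<open>a \<in> E\<close>, and at most \<open>r!\<close> such tuples give the same factorization
  (after dropping ones), so this product is at most \<open>r! f(n)\<close>. Take \<open>r = \<lfloor>ln x / ln ln x\<rfloor>\<close>;
  then \<open>r! \<le> x\<close> and the product is at most \<open>x\<^sup>2\<close>.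

  With the threshold \<open>T \<approx> sqrt (ln x) (ln ln x)\<^sup>2\<close> each exponent \<open>a\<close> contributes at least
  \<open>min a T * ln (r / T)\<close> to the logarithm of the product, and
  \<open>ln (r / T) = (1/2) ln ln x (1 + O(ln ln ln x / ln ln x))\<close>. Hence the exponents below \<open>T\<close>
  have sum at most \<open>M \<approx> 4 ln x / ln ln x\<close>, and their number of configurations is at most
  \<open>exp (pi sqrt (2 M / 3))\<close> by Rankin's trick applied to the partition generating function:
  this is the source of the constant \<open>C\<close>. The exponents above \<open>T\<close> are so few, and of size
  polynomial in \<open>ln x\<close>, that their configurations only affect the error term.
\<close>

section \<open>Dependence on the exponents only\<close>

text \<open>Multisets rather than sorted lists, because relabelling the primes changes the order of
  the factors.\<close>

definition factorization_msets :: "nat \<Rightarrow> nat multiset set" where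
  "factorization_msets n = {M. (\<forall>k\<in>#M. 1 < k) \<and> prod_mset M = n}"

lemma bij_betw_mset_factorizations:
  "bij_betw mset (unordered_factorizations n) (factorization_msets n)"
proof (rule bij_betw_imageI)
  show "inj_on mset (unordered_factorizations n)"
    by (intro inj_onI) (metis (mono_tags, lifting) mem_Collect_eq properties_for_sort
        unordered_factorizations_def)
  have "M \<in> mset ` unordered_factorizations n" if "M \<in> factorization_msets n" for M
    using that
    by (intro image_eqI[of _ _ "sorted_list_of_multiset M"])
       (auto simp: unordered_factorizations_def factorization_msets_def simp flip: prod_mset_prod_list)
  moreover have "mset ` unordered_factorizations n \<subseteq> factorization_msets n"
    by (auto simp: unordered_factorizations_def factorization_msets_def prod_mset_prod_list)
  ultimately show "mset ` unordered_factorizations n = factorization_msets n" by blast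
qed

lemma finite_factorization_msets: "finite (factorization_msets n)"
  using bij_betw_finite[OF bij_betw_mset_factorizations] finite_unordered_factorizations by blast

lemma num_unordered_factorizations_eq_card_msets:
  "num_unordered_factorizations n = card (factorization_msets n)"
  unfolding num_unordered_factorizations_def
  by (rule bij_betw_same_card[OF bij_betw_mset_factorizations])

section \<open>Exponent multisets and relabelling of primes\<close>

definition exponents :: "nat \<Rightarrow> nat multiset" where
  "exponents n = image_mset (\<lambda>p. multiplicity p n) (mset_set (prime_factors n))"

text \<open>The completely multiplicative extension of a map \<open>p\<close> on primes. Since
  \<open>prime_factorization 0\<close> is empty, 0 is sent to 1; hence the positivity conditions in
  the lemmas on inverses and products.\<close>

definition relabel_primes :: "(nat \<Rightarrow> nat) \<Rightarrow> nat \<Rightarrow> nat" where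
  "relabel_primes p d = prod_mset (image_mset p (prime_factorization d))"

lemma prime_permutes:
  assumes "p permutes A" "\<And>a. a \<in> A \<Longrightarrow> prime a" "prime q"
  shows "prime (p q)"
  using assms by (metis permutes_in_image permutes_not_in)

lemma prime_factorization_relabel_primes:
  assumes "p permutes A" "\<And>a. a \<in> A \<Longrightarrow> prime (a :: nat)"
  shows "prime_factorization (relabel_primes p d) = image_mset p (prime_factorization d)"
  unfolding relabel_primes_def
  by (rule prime_factorization_prod_mset_primes) (auto intro: prime_permutes[OF assms])

lemma relabel_primes_inv:
  assumes "p permutes A" "\<And>a. a \<in> A \<Longrightarrow> prime (a :: nat)" "d > 0"
  shows "relabel_primes (inv p) (relabel_primes p d) = d"
proof -
  have "relabel_primes (inv p) (relabel_primes p d) = prod_mset (prime_factorization d)"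
    using prime_factorization_relabel_primes[OF assms(1,2)] permutes_inverses(2)[OF assms(1)]
    by (simp add: relabel_primes_def multiset.map_comp comp_def)
  then show ?thesis using assms(3) by (simp add: prod_mset_prime_factorization_nat)
qed

lemma relabel_primes_pos:
  assumes "p permutes A" "\<And>a. a \<in> A \<Longrightarrow> prime (a :: nat)"
  shows "relabel_primes p d > 0"
proof -
  have "0 \<notin># image_mset p (prime_factorization d)"
  proof
    assume "0 \<in># image_mset p (prime_factorization d)"
    then obtain q where "q \<in> prime_factors d" "p q = 0" by auto
    with prime_permutes[OF assms, of q] show False by (simp add: in_prime_factors_imp_prime)
  qed
  then show ?thesis unfolding relabel_primes_def by (metis prod_mset_zero_iff neq0_conv)
qed

lemma relabel_primes_gt_1:
  assumes "p permutes A" "\<And>a. a \<in> A \<Longrightarrow> prime (a :: nat)" "d > 1"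
  shows "relabel_primes p d > 1"
proof -
  have "relabel_primes p d \<noteq> 1"
    using prime_factorization_relabel_primes[OF assms(1,2), of d] assms(3)
    by (auto simp: prime_factorization_empty_iff)
  then show ?thesis using relabel_primes_pos[OF assms(1,2), of d] by simp
qed

lemma relabel_primes_prod_mset:
  assumes "0 \<notin># M"
  shows "relabel_primes p (prod_mset M) = prod_mset (image_mset (relabel_primes p) M)"
  using assms
proof (induction M)
  case (add x M)
  then have "x \<noteq> 0" "prod_mset M \<noteq> 0" by auto
  then have "relabel_primes p (x * prod_mset M) = relabel_primes p x * relabel_primes p (prod_mset M)"
    by (simp add: relabel_primes_def prime_factorization_mult)
  with add show ?case by simp
qed (simp add: relabel_primes_def)

text \<open>Relabelling every factor of a factorization is injective, since relabelling by
  \<open>inv p\<close> undoes it. An inequality suffices, as it will be applied in both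
  directions.\<close>

lemma card_factorization_msets_relabel_le:
  assumes "p permutes A" "\<And>a. a \<in> A \<Longrightarrow> prime (a :: nat)"
  shows "card (factorization_msets n) \<le> card (factorization_msets (relabel_primes p n))"
proof (rule card_inj_on_le)
  have "image_mset (relabel_primes (inv p)) (image_mset (relabel_primes p) M) = M"
    if "M \<in> factorization_msets n" for M
  proof -
    have "image_mset (\<lambda>d. relabel_primes (inv p) (relabel_primes p d)) M = image_mset (\<lambda>d. d) M"
      using that by (intro image_mset_cong relabel_primes_inv[OF assms])
        (auto simp: factorization_msets_def)
    then show ?thesis by (simp add: multiset.map_comp comp_def)
  qed
  then show "inj_on (image_mset (relabel_primes p)) (factorization_msets n)"
    by (rule inj_on_inverseI)
  show "image_mset (relabel_primes p) ` factorization_msets n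
          \<subseteq> factorization_msets (relabel_primes p n)"
  proof (rule image_subsetI)
    fix M assume "M \<in> factorization_msets n"
    then have M: "\<forall>k\<in>#M. 1 < k" "prod_mset M = n" by (auto simp: factorization_msets_def)
    then have "0 \<notin># M" by auto
    with M show "image_mset (relabel_primes p) M \<in> factorization_msets (relabel_primes p n)"
      using relabel_primes_prod_mset[of M p] relabel_primes_gt_1[OF assms]
      by (auto simp: factorization_msets_def)
  qed
qed (rule finite_factorization_msets)

lemma image_mset_multiplicity_superset:
  assumes "finite A" "\<And>a. a \<in> A \<Longrightarrow> prime (a :: nat)" "prime_factors n \<subseteq> A" "n > 0"
  shows "image_mset (\<lambda>p. multiplicity p n) (mset_set A) =
           exponents n + replicate_mset (card A - size (exponents n)) 0"
proof -
  have "mset_set A = mset_set (prime_factors n) + mset_set (A - prime_factors n)"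
    using assms by (subst mset_set_Union[symmetric]) (auto intro!: arg_cong[of _ _ mset_set])
  moreover have "image_mset (\<lambda>p. multiplicity p n) (mset_set (A - prime_factors n)) =
      image_mset (\<lambda>_. 0) (mset_set (A - prime_factors n))"
    using assms by (intro image_mset_cong)
      (auto simp: prime_factors_multiplicity)
  moreover have "card (A - prime_factors n) = card A - size (exponents n)"
    using assms by (simp add: card_Diff_subset exponents_def)
  ultimately show ?thesis by (simp add: exponents_def image_mset_const_eq)
qed

lemma card_factorization_msets_le_of_exponents_eq:
  assumes "exponents n = exponents m" "n > 0" "m > 0"
  shows "card (factorization_msets n) \<le> card (factorization_msets m)"
proof -
  \<comment> \<open>Padding both exponent multisets with zeros over \<open>A\<close> yields a permutation instead of a
    bijection between the two sets of primes.\<close>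
  define A where "A = prime_factors n \<union> prime_factors m"
  have A: "finite A" "\<And>a. a \<in> A \<Longrightarrow> prime a" "prime_factors n \<subseteq> A" "prime_factors m \<subseteq> A"
    by (auto simp: A_def)
  have "image_mset (\<lambda>p. multiplicity p n) (mset_set A) =
        image_mset (\<lambda>p. multiplicity p m) (mset_set A)"
    using A assms by (simp add: image_mset_multiplicity_superset)
  then obtain p where p: "p permutes A" "\<And>q. q \<in> A \<Longrightarrow> multiplicity q n = multiplicity (p q) m"
    using image_mset_eq_implies_permutes[OF A(1)] by metis
  have "prime_factorization (relabel_primes p n) = prime_factorization m"
  proof (rule multiset_eqI)
    fix y
    obtain q where y: "y = p q" using permutes_surj[OF p(1)] by blast
    \<comment> \<open>A singleton preimage turns the count in the image multiset into a single
      count.\<close>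
    then have "p -` {y} = {q}" using permutes_inj[OF p(1)] by (auto dest: injD)
    then have "count (prime_factorization (relabel_primes p n)) y = count (prime_factorization n) q"
      by (cases "q \<in># prime_factorization n")
        (simp_all add: prime_factorization_relabel_primes[OF p(1) A(2)] count_image_mset not_in_iff)
    also have "\<dots> = count (prime_factorization m) y"
    proof (cases "q \<in> A")
      case True
      then have "y \<in> A" using permutes_in_image[OF p(1)] y by simp
      then show ?thesis using True p(2)[OF True] A(2) y
        by (simp add: count_prime_factorization_prime)
    \<comment> \<open>Outside \<open>A\<close> the permutation is the identity, and \<open>A\<close>
      contains all primes of \<open>n\<close> and \<open>m\<close>, so both counts are zero.\<close>
    next
      case False
      then have "y = q" using p(1) y by (simp add: permutes_not_in)
      then have "q \<notin># prime_factorization n" "y \<notin># prime_factorization m"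
        using False A(3,4) by blast+
      then show ?thesis by (simp add: not_in_iff)
    qed
    finally show "count (prime_factorization (relabel_primes p n)) y = count (prime_factorization m) y" .
  qed
  then have "relabel_primes p n = m"
    using relabel_primes_pos[OF p(1) A(2), of n] assms(3)
    by (metis prod_mset_prime_factorization_nat)
  then show ?thesis using card_factorization_msets_relabel_le[OF p(1) A(2), of n] by simp
qed

lemma num_unordered_factorizations_cong_exponents:
  assumes "exponents n = exponents m" "n > 0" "m > 0"
  shows "num_unordered_factorizations n = num_unordered_factorizations m"
  unfolding num_unordered_factorizations_eq_card_msets
  using assms by (intro antisym card_factorization_msets_le_of_exponents_eq) auto

section \<open>Ordered factorizations with a fixed number of factors\<close>

lemma card_permutations_of_multiset_le_fact:
  "card (permutations_of_multiset A) \<le> fact (size A)"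
  by (simp add: card_permutations_of_multiset(1))

text \<open>Deleting the ones from a tuple leaves a factorization of \<open>n\<close>, and padding
  that with ones up to size \<open>r\<close> restores the multiset of entries. So the tuple is an
  ordering of a padded factorization.\<close>

lemma lists_of_prod_subset:
  assumes "n > 0"
  shows "{l :: nat list. length l = r \<and> prod_list l = n} \<subseteq>
    (\<Union>M\<in>{M\<in>factorization_msets n. size M \<le> r}.
        permutations_of_multiset (M + replicate_mset (r - size M) 1))"
proof safe
  fix l :: "nat list"
  assume n: "n = prod_list l"
  define M where "M = filter_mset (\<lambda>k. k \<noteq> 1) (mset l)"
  have split: "mset l = M + replicate_mset (count (mset l) 1) 1"
    unfolding M_def by (subst multiset_partition[of _ "\<lambda>k. k \<noteq> 1"]) (simp flip: filter_eq_replicate_mset)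
  have size: "size (mset l) = size M + count (mset l) 1"
    by (subst split) simp
  have "prod_mset (mset l) = prod_mset M" by (subst split) simp
  then have "prod_mset M = n" using n by (simp add: prod_mset_prod_list)
  moreover have "0 \<notin> set l" using assms n by (metis prod_list_zero_iff less_irrefl)
  ultimately have "M \<in> factorization_msets n"
    by (auto simp: factorization_msets_def M_def intro: Suc_lessI)
       (metis One_nat_def Suc_lessI neq0_conv)
  moreover have "l \<in> permutations_of_multiset (M + replicate_mset (length l - size M) 1)"
    using split size by (simp add: permutations_of_multiset_def)
  ultimately show "l \<in> (\<Union>M\<in>{M\<in>factorization_msets (prod_list l). size M \<le> length l}.
        permutations_of_multiset (M + replicate_mset (length l - size M) 1))"
    using size n by auto
qed

lemma finite_lists_of_prod: "n > 0 \<Longrightarrow> finite {l :: nat list. length l = r \<and> prod_list l = n}"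
  by (rule finite_subset[OF lists_of_prod_subset]) (auto simp: finite_factorization_msets)

lemma card_lists_of_prod_le:
  assumes "n > 0"
  shows "card {l :: nat list. length l = r \<and> prod_list l = n} \<le> fact r * card (factorization_msets n)"
proof -
  let ?I = "{M\<in>factorization_msets n. size M \<le> r}"
  let ?P = "\<lambda>M. permutations_of_multiset (M + replicate_mset (r - size M) 1)"
  have fin: "finite ?I" by (simp add: finite_factorization_msets)
  have "card {l :: nat list. length l = r \<and> prod_list l = n} \<le> card (\<Union>M\<in>?I. ?P M)"
    by (rule card_mono[OF _ lists_of_prod_subset[OF assms]]) (auto simp: fin)
  also have "\<dots> \<le> (\<Sum>M\<in>?I. card (?P M))" by (rule card_UN_le[OF fin])
  also have "\<dots> \<le> (\<Sum>M\<in>?I. fact r)"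
    by (intro sum_mono order.trans[OF card_permutations_of_multiset_le_fact]) simp
  also have "\<dots> \<le> fact r * card (factorization_msets n)"
    using card_mono[OF finite_factorization_msets, of ?I n] by (simp add: mult.commute)
  finally show ?thesis .
qed

text \<open>Spreading the exponent \<open>a\<close> of one prime over \<open>r\<close> positions is
  a weak composition of \<open>a\<close> into \<open>r\<close> parts, counted by the binomial.
  Primes are treated independently, and unique factorization recovers all the choices from the
  tuple.\<close>

lemma prod_binomial_le_card_lists_of_prod:
  assumes "n > 0"
  shows "(\<Prod>a\<in>#exponents n. (a + r - 1) choose a) \<le> card {l :: nat list. length l = r \<and> prod_list l = n}"
proof -
  define S where "S = prime_factors n"
  define L where "L q = {l :: nat list. length l = r \<and> sum_list l = multiplicity q n}" for q
  \<comment> \<open>\<open>g q\<close> lists the exponents of \<open>q\<close> in the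
    \<open>r\<close> factors; \<open>\<Phi> g\<close> is the resulting tuple.\<close>
  define \<Phi> where "\<Phi> g = map (\<lambda>i. \<Prod>q\<in>S. q ^ (g q ! i)) [0..<r]" for g :: "nat \<Rightarrow> nat list"
  have "(\<Prod>a\<in>#exponents n. (a + r - 1) choose a) = (\<Prod>q\<in>S. card (L q))"
    by (simp add: exponents_def S_def L_def card_length_sum_list multiset.map_comp comp_def
        prod_unfold_prod_mset)
  also have "\<dots> = card (Pi\<^sub>E S L)" by (simp add: card_PiE S_def)
  also have "\<dots> \<le> card {l :: nat list. length l = r \<and> prod_list l = n}"
  proof (rule card_inj_on_le[of \<Phi>])
    show "inj_on \<Phi> (Pi\<^sub>E S L)"
    proof (rule inj_onI)
      fix g h assume g: "g \<in> Pi\<^sub>E S L" and h: "h \<in> Pi\<^sub>E S L" and eq: "\<Phi> g = \<Phi> h"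
      show "g = h"
      proof (rule PiE_ext[OF g h])
        fix q assume q: "q \<in> S"
        have "g q ! i = h q ! i" if "i < r" for i
        proof -
          have "(\<Prod>q\<in>S. q ^ (g q ! i)) = (\<Prod>q\<in>S. q ^ (h q ! i))"
            using that arg_cong[OF eq, of "\<lambda>l. l ! i"] by (simp add: \<Phi>_def)
          then have "multiplicity q (\<Prod>q\<in>S. q ^ (g q ! i)) = multiplicity q (\<Prod>q\<in>S. q ^ (h q ! i))"
            by simp
          then show ?thesis using q
            by (subst (asm) (1 2) multiplicity_prod_prime_powers) (auto simp: S_def)
        qed
        moreover have "length (g q) = r" "length (h q) = r"
          using PiE_mem[OF g q] PiE_mem[OF h q] by (auto simp: L_def)
        ultimately show "g q = h q" by (simp add: nth_equalityI)
      qed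
    qed
    show "\<Phi> ` Pi\<^sub>E S L \<subseteq> {l :: nat list. length l = r \<and> prod_list l = n}"
    proof (rule image_subsetI)
      fix g assume g: "g \<in> Pi\<^sub>E S L"
      have "prod_list (\<Phi> g) = (\<Prod>i<r. \<Prod>q\<in>S. q ^ (g q ! i))"
        by (simp add: \<Phi>_def prod.distinct_set_conv_list[symmetric] atLeast0LessThan)
      also have "\<dots> = (\<Prod>q\<in>S. q ^ (\<Sum>i<r. g q ! i))"
        by (subst prod.swap) (simp add: power_sum)
      also have "\<dots> = (\<Prod>q\<in>S. q ^ multiplicity q n)"
      proof (intro prod.cong refl)
        fix q assume "q \<in> S"
        from PiE_mem[OF g this] show "q ^ (\<Sum>i<r. g q ! i) = q ^ multiplicity q n"
          by (auto simp: L_def sum_list_sum_nth atLeast0LessThan)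
      qed
      also have "\<dots> = n" using prime_factorization_nat[OF assms] by (simp add: S_def)
      finally show "\<Phi> g \<in> {l. length l = r \<and> prod_list l = n}" by (simp add: \<Phi>_def)
    qed
  qed (rule finite_lists_of_prod[OF assms])
  finally show ?thesis .
qed

lemma prod_binomial_exponents_le:
  assumes "n > 0"
  shows "(\<Prod>a\<in>#exponents n. (a + r - 1) choose a) \<le> fact r * num_unordered_factorizations n"
  unfolding num_unordered_factorizations_eq_card_msets
  using prod_binomial_le_card_lists_of_prod[OF assms] card_lists_of_prod_le[OF assms] by (rule order.trans)

section \<open>Counting multisets of positive integers\<close>

lemma prod_power_count_eq_power_sum_mset:
  fixes q :: real
  assumes "finite S" "set_mset A \<subseteq> S"
  shows "(\<Prod>k\<in>S. (q ^ k) ^ count A k) = q ^ sum_mset A"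
  using assms(2)
proof (induction A)
  case (add x A)
  have "(\<Prod>k\<in>S. (q ^ k) ^ count (add_mset x A) k) =
        (\<Prod>k\<in>S. (if k = x then q ^ k else 1) * (q ^ k) ^ count A k)"
    by (intro prod.cong) auto
  also have "\<dots> = (\<Prod>k\<in>S. if k = x then q ^ k else 1) * q ^ sum_mset A"
    using add by (subst prod.distrib) simp
  also have "\<dots> = q ^ sum_mset (add_mset x A)"
    using add.prems assms(1) by (simp add: power_add)
  finally show ?case .
qed simp

text \<open>A multiset is determined by its multiplicities, so its weight is one term in the
  expansion of a product of geometric series, one for each part size. All terms are nonnegative, so
  dropping the others only decreases the sum.\<close>

lemma sum_power_sum_mset_le_prod:
  fixes q :: real
  assumes "finite F" "\<And>A. A \<in> F \<Longrightarrow> set_mset A \<subseteq> {1..N}" "0 < q" "q < 1"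
  shows "(\<Sum>A\<in>F. q ^ sum_mset A) \<le> (\<Prod>k=1..N. 1 / (1 - q ^ k))"
proof -
  \<comment> \<open>\<open>K\<close> bounds every multiplicity occurring in \<open>F\<close>; the
    geometric series can then be truncated at \<open>K\<close> and the expansion stays
    finite.\<close>
  define K where "K = (\<Sum>A\<in>F. size A)"
  define c where "c A = restrict (count A) {1..N}" for A :: "nat multiset"
  have inj: "inj_on c F"
  proof (intro inj_onI multiset_eqI)
    fix A B k assume AB: "A \<in> F" "B \<in> F" and eq: "c A = c B"
    show "count A k = count B k"
    proof (cases "k \<in> {1..N}")
      case True
      then show ?thesis using fun_cong[OF eq, of k] by (simp add: c_def)
    next
      case False
      then have "k \<notin># A" "k \<notin># B" using assms(2) AB by blast+
      then show ?thesis by (simp add: not_in_iff)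
    qed
  qed
  have "count A k \<le> K" if "A \<in> F" for A k
    unfolding K_def using assms(1) that count_le_size[of A k] member_le_sum[of A F size] by simp
  then have sub: "c ` F \<subseteq> (\<Pi>\<^sub>E k\<in>{1..N}. {..K})" by (auto simp: c_def)
  have "(\<Sum>A\<in>F. q ^ sum_mset A) = (\<Sum>A\<in>F. \<Prod>k=1..N. (q ^ k) ^ c A k)"
    using assms(2) by (intro sum.cong refl) (simp add: c_def flip: prod_power_count_eq_power_sum_mset)
  also have "\<dots> = (\<Sum>g\<in>c ` F. \<Prod>k=1..N. (q ^ k) ^ g k)"
    by (simp add: sum.reindex[OF inj])
  also have "\<dots> \<le> (\<Sum>g\<in>(\<Pi>\<^sub>E k\<in>{1..N}. {..K}). \<Prod>k=1..N. (q ^ k) ^ g k)"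
    using assms(3) by (intro sum_mono2[OF _ sub] finite_PiE) (auto intro!: prod_nonneg)
  also have "\<dots> = (\<Prod>k=1..N. \<Sum>j\<le>K. (q ^ k) ^ j)"
    by (subst prod_sum_PiE) auto
  also have "\<dots> \<le> (\<Prod>k=1..N. 1 / (1 - q ^ k))"
  proof (intro prod_mono conjI)
    fix k assume "k \<in> {1..N}"
    then have "q ^ k < 1" "0 < q ^ k" using assms by (auto simp: power_less_one_iff)
    moreover from this have "(\<Sum>j\<le>K. (q ^ k) ^ j) \<le> (\<Sum>j. (q ^ k) ^ j)"
      by (intro sum_le_suminf summable_geometric) auto
    ultimately show "(\<Sum>j\<le>K. (q ^ k) ^ j) \<le> 1 / (1 - q ^ k)"
      by (simp add: suminf_geometric)
    show "0 \<le> (\<Sum>j\<le>K. (q ^ k) ^ j)" using \<open>0 < q ^ k\<close> by (intro sum_nonneg) simp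
  qed
  finally show ?thesis .
qed

text \<open>The full geometric series is \<open>1 / (exp t - 1)\<close>, and
  \<open>exp t >= 1 + t\<close>.\<close>

lemma sum_exp_neg_le:
  fixes t :: real
  assumes "t > 0"
  shows "(\<Sum>k=1..N. exp (- t) ^ k) \<le> 1 / t"
proof -
  define q where "q = exp (- t)"
  have q: "0 < q" "q < 1" using assms by (auto simp: q_def)
  have "(\<Sum>k=1..N. q ^ k) = q * (\<Sum>k<N. q ^ k)"
    by (simp add: sum_distrib_left sum.atLeast1_atMost_eq)
  also have "\<dots> \<le> q * (1 / (1 - q))"
    using q sum_le_suminf[OF summable_geometric[of q], of "{..<N}"]
    by (intro mult_left_mono) (auto simp: suminf_geometric)
  also have "\<dots> \<le> 1 / t"
  proof -
    have "1 + t \<le> exp t" by (rule exp_ge_add_one_self)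
    then have "q * (1 + t) \<le> q * exp t" using q by (intro mult_left_mono) auto
    then have "q * t \<le> 1 - q" by (simp add: q_def algebra_simps flip: exp_add)
    then show ?thesis using q assms by (simp add: field_simps)
  qed
  finally show ?thesis by (simp add: q_def)
qed

text \<open>Expand each \<open>- ln (1 - q ^ k)\<close> as the series of
  \<open>(q ^ k) ^ m / m\<close> and sum over \<open>k\<close> first: the \<open>m\<close>-th term
  is at most \<open>1 / (t * m)\<close> divided by \<open>m\<close>. The sum of inverse squares
  supplies \<open>pi\<^sup>2 / 6\<close>.\<close>

lemma prod_geometric_le_exp:
  fixes t :: real
  assumes "t > 0"
  shows "(\<Prod>k=1..N. 1 / (1 - exp (- t) ^ k)) \<le> exp (pi\<^sup>2 / (6 * t))"
proof -
  define q where "q = exp (- t)"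
  have q: "0 < q" "q < 1" using assms by (auto simp: q_def)
  have qk: "0 < q ^ k" "q ^ k < 1" if "k \<in> {1..N}" for k
    using that q by (auto simp: power_less_one_iff)
  have "(\<lambda>m. \<Sum>k=1..N. - ((q ^ k) ^ m) / real m) sums (\<Sum>k=1..N. ln (1 - q ^ k))"
  proof (rule sums_sum)
    fix k assume k: "k \<in> {1..N}"
    have "(\<lambda>n. - ((- (- (q ^ k))) ^ n) / of_nat n) sums ln (1 + - (q ^ k))"
      using qk[OF k] by (intro ln_series') auto
    then show "(\<lambda>m. - ((q ^ k) ^ m) / real m) sums ln (1 - q ^ k)" by simp
  qed
  from sums_minus[OF this]
  have 1: "(\<lambda>m. \<Sum>k=1..N. (q ^ k) ^ m / real m) sums (- (\<Sum>k=1..N. ln (1 - q ^ k)))"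
    by (simp flip: sum_negf)
  \<comment> \<open>The sum starts at \<open>m = 0\<close> to match the logarithm series; that term
    vanishes because division by zero gives 0.\<close>
  have "(\<lambda>m. 1 / (real m)\<^sup>2) sums (pi\<^sup>2 / 6)"
    using inverse_squares_sums sums_Suc_iff[of "\<lambda>m. 1 / (real m)\<^sup>2" "pi\<^sup>2 / 6"]
    by (simp add: add.commute)
  then have 2: "(\<lambda>m. 1 / t * (1 / (real m)\<^sup>2)) sums (1 / t * (pi\<^sup>2 / 6))" by (rule sums_mult)
  have "- (\<Sum>k=1..N. ln (1 - q ^ k)) \<le> 1 / t * (pi\<^sup>2 / 6)"
  proof (rule sums_le[OF _ 1 2])
    fix m
    show "(\<Sum>k=1..N. (q ^ k) ^ m / real m) \<le> 1 / t * (1 / (real m)\<^sup>2)"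
    proof (cases "m = 0")
      case False
      have "q ^ m = exp (- (t * m))" by (simp add: q_def flip: exp_of_nat_mult)
      then have "(q ^ k) ^ m = exp (- (t * m)) ^ k" for k by (metis power_mult mult.commute)
      then have "(\<Sum>k=1..N. (q ^ k) ^ m) \<le> 1 / (t * m)"
        using sum_exp_neg_le[of "t * m" N] assms False by simp
      then have "(\<Sum>k=1..N. (q ^ k) ^ m) / real m \<le> 1 / (t * m) / real m"
        by (rule divide_right_mono) simp
      then show ?thesis by (simp add: sum_divide_distrib power2_eq_square mult.assoc)
    qed simp
  qed
  also have "1 / t * (pi\<^sup>2 / 6) = pi\<^sup>2 / (6 * t)" by simp
  finally have "exp (- (\<Sum>k=1..N. ln (1 - q ^ k))) \<le> exp (pi\<^sup>2 / (6 * t))" by simp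
  moreover have "exp (- (\<Sum>k=1..N. ln (1 - q ^ k))) = (\<Prod>k=1..N. 1 / (1 - q ^ k))"
    unfolding sum_negf[symmetric] exp_sum[OF finite_atLeastAtMost]
    using qk by (intro prod.cong refl) (simp add: exp_minus divide_inverse)
  ultimately show ?thesis by (simp only: q_def)
qed

text \<open>The integer partitions of all numbers up to \<open>M\<close>; excluding the part 0 keeps
  the set finite.\<close>

definition msets_sum_le :: "real \<Rightarrow> nat multiset set" where
  "msets_sum_le M = {A. 0 \<notin># A \<and> real (sum_mset A) \<le> M}"

lemma size_le_sum_mset: "0 \<notin># A \<Longrightarrow> size A \<le> (sum_mset A :: nat)"
proof (induction A)
  case (add x A)
  then show ?case by (cases x) auto
qed simp

lemma finite_msets_bounded: "finite {A :: nat multiset. set_mset A \<subseteq> {..N} \<and> size A \<le> N}"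
proof (rule finite_subset)
  show "{A :: nat multiset. set_mset A \<subseteq> {..N} \<and> size A \<le> N} \<subseteq>
      mset ` {l. set l \<subseteq> {..N} \<and> length l \<le> N}"
  proof
    fix A :: "nat multiset" assume "A \<in> {A. set_mset A \<subseteq> {..N} \<and> size A \<le> N}"
    then show "A \<in> mset ` {l. set l \<subseteq> {..N} \<and> length l \<le> N}"
      by (intro image_eqI[of _ _ "sorted_list_of_multiset A"])
        (auto simp flip: size_mset)
  qed
qed (intro finite_imageI finite_lists_length_le, simp)

lemma msets_sum_le_subset:
  "msets_sum_le M \<subseteq> {A. set_mset A \<subseteq> {1..nat \<lfloor>M\<rfloor>} \<and> size A \<le> nat \<lfloor>M\<rfloor>}"
proof
  fix A assume "A \<in> msets_sum_le M"
  then have A: "0 \<notin># A" "sum_mset A \<le> nat \<lfloor>M\<rfloor>"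
    by (auto simp: msets_sum_le_def le_nat_floor)
  have "set_mset A \<subseteq> {1..nat \<lfloor>M\<rfloor>}"
  proof
    fix a assume a: "a \<in># A"
    then have "a \<le> sum_mset A" by (auto dest!: multi_member_split)
    moreover have "a \<noteq> 0" using a A(1) by metis
    ultimately show "a \<in> {1..nat \<lfloor>M\<rfloor>}" using A(2) by simp
  qed
  then show "A \<in> {A. set_mset A \<subseteq> {1..nat \<lfloor>M\<rfloor>} \<and> size A \<le> nat \<lfloor>M\<rfloor>}"
    using size_le_sum_mset[OF A(1)] A(2) by simp
qed

lemma finite_msets_sum_le: "finite (msets_sum_le M)"
  by (rule finite_subset[OF msets_sum_le_subset])
     (rule finite_subset[OF _ finite_msets_bounded[of "nat \<lfloor>M\<rfloor>"]], auto)

text \<open>Rankin's trick: each counted multiset has weight \<open>exp (- t) ^ sum_mset A\<close>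
  at least \<open>exp (- (t * M))\<close>, so the generating function bounds their number for every
  \<open>t > 0\<close>.\<close>

lemma card_msets_sum_le:
  assumes "M > 0"
  shows "real (card (msets_sum_le M)) \<le> exp (pi * sqrt (2 / 3 * M))"
proof -
  \<comment> \<open>the minimizer of \<open>pi\<^sup>2 / (6 * t) + t * M\<close>\<close>
  define t where "t = pi / sqrt (6 * M)"
  have t: "t > 0" using assms by (simp add: t_def)
  have "real (card (msets_sum_le M)) * exp (- (t * M)) = (\<Sum>A\<in>msets_sum_le M. exp (- (t * M)))"
    by simp
  also have "\<dots> \<le> (\<Sum>A\<in>msets_sum_le M. exp (- t) ^ sum_mset A)"
    using t by (intro sum_mono)
      (auto simp: msets_sum_le_def mult.commute simp flip: exp_of_nat_mult)
  also have "\<dots> \<le> (\<Prod>k=1..nat \<lfloor>M\<rfloor>. 1 / (1 - exp (- t) ^ k))"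
    using t msets_sum_le_subset[of M]
    by (intro sum_power_sum_mset_le_prod finite_msets_sum_le) auto
  also have "\<dots> \<le> exp (pi\<^sup>2 / (6 * t))" by (rule prod_geometric_le_exp[OF t])
  finally have "real (card (msets_sum_le M)) \<le> exp (pi\<^sup>2 / (6 * t) + t * M)"
    by (simp add: exp_add exp_minus field_simps)
  also have "pi\<^sup>2 / (6 * t) + t * M = pi * sqrt (2 / 3 * M)"
  proof -
    define s where "s = sqrt (6 * M)"
    have s: "s > 0" "M = s\<^sup>2 / 6" using assms by (auto simp: s_def)
    have "sqrt (2 / 3 * M) = sqrt ((s / 3)\<^sup>2)" by (simp add: s(2) power_divide)
    also have "\<dots> = s / 3" using s(1) by simp
    finally have e: "sqrt (2 / 3 * M) = s / 3" .
    show ?thesis unfolding e t_def s_def[symmetric] using s(1)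
      by (subst s(2)) (simp add: field_simps power2_eq_square)
  qed
  finally show ?thesis .
qed

section \<open>Multisets with few elements of bounded size\<close>

definition msets_size_le :: "real \<Rightarrow> real \<Rightarrow> nat multiset set" where
  "msets_size_le J B = {A. 0 \<notin># A \<and> real (size A) \<le> J \<and> (\<forall>a\<in>#A. real a \<le> B)}"

text \<open>Padding with zeros gives words of one fixed length, and filtering out the zeros recovers
  the multiset. The count is thus at most that of words over an alphabet of
  \<open>nat \<lfloor>B\<rfloor> + 1\<close> letters.\<close>

lemma msets_size_le_subset:
  "msets_size_le J B \<subseteq> (\<lambda>l. filter_mset (\<lambda>a. a \<noteq> 0) (mset l)) `
     {l. set l \<subseteq> {..nat \<lfloor>B\<rfloor>} \<and> length l = nat \<lfloor>J\<rfloor>}"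
proof
  fix A assume "A \<in> msets_size_le J B"
  then have A: "0 \<notin># A" "size A \<le> nat \<lfloor>J\<rfloor>" "\<And>a. a \<in># A \<Longrightarrow> a \<le> nat \<lfloor>B\<rfloor>"
    by (auto simp: msets_size_le_def le_nat_floor)
  define l where "l = sorted_list_of_multiset A @ replicate (nat \<lfloor>J\<rfloor> - size A) 0"
  have "length l = nat \<lfloor>J\<rfloor>" using A(2) by (simp add: l_def flip: size_mset)
  moreover have "set l \<subseteq> {..nat \<lfloor>B\<rfloor>}" using A(3) by (auto simp: l_def)
  moreover have "filter_mset (\<lambda>a. a \<noteq> 0) (mset l) = A"
    using A(1) by (auto simp: l_def multiset_eq_iff not_in_iff)
  ultimately show "A \<in> (\<lambda>l. filter_mset (\<lambda>a. a \<noteq> 0) (mset l)) `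
     {l. set l \<subseteq> {..nat \<lfloor>B\<rfloor>} \<and> length l = nat \<lfloor>J\<rfloor>}" by blast
qed

lemma finite_msets_size_le: "finite (msets_size_le J B)"
  by (rule finite_subset[OF msets_size_le_subset]) (intro finite_imageI finite_lists_length_eq, simp)

lemma card_msets_size_le:
  assumes "J \<ge> 0" "B \<ge> 0"
  shows "real (card (msets_size_le J B)) \<le> exp (J * ln (B + 1))"
proof -
  have "card (msets_size_le J B) \<le> card {l. set l \<subseteq> {..nat \<lfloor>B\<rfloor>} \<and> length l = nat \<lfloor>J\<rfloor>}"
    by (rule surj_card_le[OF _ msets_size_le_subset]) (intro finite_lists_length_eq, simp)
  also have "\<dots> = (nat \<lfloor>B\<rfloor> + 1) ^ nat \<lfloor>J\<rfloor>" by (subst card_lists_length_eq) auto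
  finally have "real (card (msets_size_le J B)) \<le> (real (nat \<lfloor>B\<rfloor>) + 1) ^ nat \<lfloor>J\<rfloor>"
    by (metis of_nat_1 of_nat_add of_nat_le_iff of_nat_power)
  also have "\<dots> \<le> (B + 1) ^ nat \<lfloor>J\<rfloor>" using assms by (intro power_mono) auto
  also have "\<dots> = exp (real (nat \<lfloor>J\<rfloor>) * ln (B + 1))"
    unfolding exp_of_nat_mult using assms by simp
  also have "\<dots> \<le> exp (J * ln (B + 1))" using assms by (auto intro!: mult_right_mono)
  finally show ?thesis .
qed

section \<open>Counting exponent multisets\<close>

definition binomial_weight :: "nat \<Rightarrow> nat multiset \<Rightarrow> nat" where
  "binomial_weight r A = (\<Prod>a\<in>#A. (a + r - 1) choose a)"

text \<open>For \<open>b \<le> T\<close> the binomial is at least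
  \<open>((b + r - 1) / b) ^ b\<close>, hence at least \<open>(r / T) ^ b\<close>. Larger exponents
  are compared with \<open>T\<close> itself.\<close>

lemma exp_min_le_binomial:
  assumes "a > 0" "T > 0" "T < r"
  shows "exp (ln (real r / real T) * real (min a T)) \<le> real ((a + r - 1) choose a)"
proof -
  have *: "exp (ln (real r / real T) * real b) \<le> real ((b + r - 1) choose b)"
    if "0 < b" "b \<le> T" for b
  proof -
    have "exp (ln (real r / real T) * real b) = (real r / real T) ^ b"
      using assms by (simp add: mult.commute[of _ "real b"] exp_of_nat_mult)
    also have "\<dots> \<le> (real (b + r - 1) / real b) ^ b"
      using that assms by (intro power_mono frac_le) auto
    also have "\<dots> \<le> real ((b + r - 1) choose b)"
      using assms by (intro binomial_ge_n_over_k_pow_k) auto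
    finally show ?thesis .
  qed
  show ?thesis
  proof (cases "a \<le> T")
    case True
    then show ?thesis using *[of a] assms by (simp add: min_def)
  next
    case False
    \<comment> \<open>With the lower index \<open>r - 1\<close> held fixed, the binomial is monotone
      in its upper index.\<close>
    have "(T + r - 1) choose T = (T + r - 1) choose (r - 1)"
      using assms binomial_symmetric[of T "T + r - 1"] by simp
    also have "\<dots> \<le> (a + r - 1) choose (r - 1)"
      using False by (intro binomial_right_mono) auto
    also have "\<dots> = (a + r - 1) choose a"
      using assms binomial_symmetric[of a "a + r - 1"] by simp
    finally have "real ((T + r - 1) choose T) \<le> real ((a + r - 1) choose a)" by simp
    then show ?thesis using *[of T] assms False by (simp add: min_def)
  qed
qed

lemma exp_sum_min_le_binomial_weight:
  assumes "0 \<notin># A" "T > 0" "T < r"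
  shows "exp (ln (real r / real T) * real (\<Sum>a\<in>#A. min a T)) \<le> real (binomial_weight r A)"
  using assms(1)
proof (induction A)
  case (add a A)
  then have "exp (ln (real r / real T) * real (min a T)) * exp (ln (real r / real T) * real (\<Sum>a\<in>#A. min a T))
     \<le> real ((a + r - 1) choose a) * real (binomial_weight r A)"
    using exp_min_le_binomial[OF _ assms(2,3), of a] by (intro mult_mono) auto
  then show ?case by (simp add: binomial_weight_def distrib_left exp_add)
qed (simp add: binomial_weight_def)

lemma binomial_weight_pos: "r > 0 \<Longrightarrow> binomial_weight r A > 0"
  by (induction A) (auto simp: binomial_weight_def)

text \<open>One exponent already contributes at least \<open>(a / (r - 1)) ^ (r - 1)\<close>, and
  the remaining factors of the weight are at least 1; take the \<open>(r - 1)\<close>-th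
  root.\<close>

lemma member_le_of_binomial_weight_le:
  assumes "a \<in># A" "r \<ge> 2" "real (binomial_weight r A) \<le> exp W"
  shows "real a \<le> (real r - 1) * exp (W / (real r - 1))"
proof -
  obtain A' where A': "A = add_mset a A'" using assms(1) by (metis multi_member_split)
  have "(real a / real (r - 1)) ^ (r - 1) \<le> (real (a + r - 1) / real (r - 1)) ^ (r - 1)"
    using assms(2) by (intro power_mono divide_right_mono) auto
  also have "\<dots> \<le> real ((a + r - 1) choose (r - 1))"
    using assms(2) by (intro binomial_ge_n_over_k_pow_k) auto
  also have "(a + r - 1) choose (r - 1) = (a + r - 1) choose a"
    using assms(2) binomial_symmetric[of a "a + r - 1"] by simp
  also have "\<dots> \<le> binomial_weight r A"
    using binomial_weight_pos[of r A'] assms(2) by (simp add: A' binomial_weight_def Suc_leI)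
  also note assms(3)
  also have "exp W = exp (W / (real r - 1)) ^ (r - 1)"
    using assms(2) by (simp add: of_nat_diff flip: exp_of_nat_mult)
  finally have "real a / real (r - 1) \<le> exp (W / (real r - 1))"
    using power_mono_iff[of "real a / real (r - 1)" "exp (W / (real r - 1))" "r - 1"] assms(2) by simp
  then show ?thesis using assms(2) by (simp add: of_nat_diff field_simps)
qed

text \<open>Split each multiset at \<open>T\<close> into small elements \<open>X\<close> and large
  elements \<open>Y\<close>. The weight bound gives \<open>w * (sum X + T * size Y) \<le> W\<close>,
  so \<open>X\<close> is a partition of a number up to \<open>W / w\<close>, while \<open>Y\<close>
  has at most \<open>W / (T * w)\<close> elements, each at most \<open>B\<close>.\<close>

lemma card_binomial_weight_le:
  fixes W :: real and r T :: nat
  assumes "r \<ge> 2" "T > 0" "T < r" "W > 0"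
  defines "w \<equiv> ln (real r / real T)" and "B \<equiv> (real r - 1) * exp (W / (real r - 1))"
  defines "P \<equiv> {A. 0 \<notin># A \<and> real (binomial_weight r A) \<le> exp W}"
  shows "finite P"
    and "real (card P) \<le> exp (pi * sqrt (2 / 3 * (W / w)) + W / (real T * w) * ln (B + 1))"
proof -
  have w: "w > 0" using assms by (simp add: w_def)
  have B: "B \<ge> 0" using assms by (simp add: B_def)
  define s where "s A = (filter_mset (\<lambda>a. a < T) A, filter_mset (\<lambda>a. \<not> a < T) A)" for A :: "nat multiset"
  let ?S = "msets_sum_le (W / w) \<times> msets_size_le (W / (real T * w)) B"
  have inj: "inj_on s P"
    by (rule inj_on_inverseI[of _ "\<lambda>(A, B). A + B"]) (simp add: s_def flip: multiset_partition)
  have fin: "finite ?S" by (intro finite_cartesian_product finite_msets_sum_le finite_msets_size_le)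
  have sub: "s ` P \<subseteq> ?S"
  proof (rule image_subsetI)
    fix A assume "A \<in> P"
    then have A: "0 \<notin># A" "real (binomial_weight r A) \<le> exp W" by (auto simp: P_def)
    define X Y where "X = filter_mset (\<lambda>a. a < T) A" and "Y = filter_mset (\<lambda>a. \<not> a < T) A"
    have "exp (w * real (\<Sum>a\<in>#A. min a T)) \<le> exp W"
      unfolding w_def by (rule order.trans[OF exp_sum_min_le_binomial_weight[OF A(1) assms(2,3)] A(2)])
    then have "w * real (\<Sum>a\<in>#A. min a T) \<le> W" unfolding exp_le_cancel_iff .
    also have "(\<Sum>a\<in>#A. min a T) = (\<Sum>a\<in>#X. min a T) + (\<Sum>a\<in>#Y. min a T)"
      unfolding X_def Y_def by (metis image_mset_union multiset_partition sum_mset.union)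
    also have "(\<Sum>a\<in>#X. min a T) = (\<Sum>a\<in>#X. a)"
      by (intro arg_cong[of _ _ sum_mset] image_mset_cong) (auto simp: X_def)
    also have "(\<Sum>a\<in>#Y. min a T) = (\<Sum>a\<in>#Y. T)"
      by (intro arg_cong[of _ _ sum_mset] image_mset_cong) (auto simp: Y_def)
    finally have le: "w * (real (sum_mset X) + real (size Y) * real T) \<le> W"
      by (simp add: sum_mset_constant)
    have "w * real (sum_mset X) \<le> W"
      by (rule order.trans[OF _ le], rule mult_left_mono)
         (use w of_nat_0_le_iff[of "sum_mset X"] in \<open>simp_all del: of_nat_sum_mset\<close>)
    then have "X \<in> msets_sum_le (W / w)"
      using A(1) w by (auto simp: msets_sum_le_def X_def field_simps)
    moreover have "w * (real (size Y) * real T) \<le> W"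
      by (rule order.trans[OF _ le], rule mult_left_mono)
         (use w of_nat_0_le_iff[of "sum_mset X"] in \<open>simp_all del: of_nat_sum_mset\<close>)
    then have "real (size Y) \<le> W / (real T * w)"
      using w assms(2) by (simp add: field_simps)
    then have "Y \<in> msets_size_le (W / (real T * w)) B"
      using A(1) member_le_of_binomial_weight_le[OF _ assms(1) A(2)]
      by (auto simp: msets_size_le_def Y_def B_def)
    ultimately show "s A \<in> ?S" by (simp add: s_def X_def Y_def)
  qed
  show "finite P" using inj_on_finite[OF inj sub fin] .
  have "real (card P) \<le> real (card (msets_sum_le (W / w))) * real (card (msets_size_le (W / (real T * w)) B))"
    using card_inj_on_le[OF inj sub fin] by (simp add: card_cartesian_product flip: of_nat_mult)
  also have "\<dots> \<le> exp (pi * sqrt (2 / 3 * (W / w))) * exp (W / (real T * w) * ln (B + 1))"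
    using assms(2,4) w B by (intro mult_mono card_msets_sum_le card_msets_size_le) auto
  finally show "real (card P) \<le> exp (pi * sqrt (2 / 3 * (W / w)) + W / (real T * w) * ln (B + 1))"
    by (simp add: exp_add)
qed

lemma card_factorization_count_values_le:
  fixes x W :: real and r T :: nat
  assumes "r \<ge> 2" "T > 0" "T < r" "W > 0" "fact r * x \<le> exp W"
  shows "real (card (factorization_count_values x)) \<le>
    exp (pi * sqrt (2 / 3 * (W / ln (real r / real T))) +
      W / (real T * ln (real r / real T)) * ln ((real r - 1) * exp (W / (real r - 1)) + 1))"
proof -
  define P where "P = {A. 0 \<notin># A \<and> real (binomial_weight r A) \<le> exp W}"
  define V where "V = {n. n > 0 \<and> real (num_unordered_factorizations n) \<le> x}"
  have "exponents n \<in> P" if "n \<in> V" for n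
  proof -
    have "real (binomial_weight r (exponents n)) \<le> real (fact r * num_unordered_factorizations n)"
      unfolding binomial_weight_def of_nat_le_iff
      using that by (intro prod_binomial_exponents_le) (simp add: V_def)
    also have "\<dots> \<le> fact r * x" using that by (simp add: V_def)
    also note assms(5)
    finally have "real (binomial_weight r (exponents n)) \<le> exp W" .
    moreover have "multiplicity p n \<noteq> 0" if "p \<in> prime_factors n" for p
      using that by (simp add: prime_factors_multiplicity)
    then have "0 \<notin># exponents n" by (force simp: exponents_def)
    ultimately show ?thesis by (simp add: P_def)
  qed
  then have sub: "exponents ` V \<subseteq> P" by blast
  have fin: "finite (exponents ` V)"
    using finite_subset[OF sub] card_binomial_weight_le(1)[OF assms(1-4)] by (simp add: P_def)
  \<comment> \<open>Each exponent multiset gets a chosen representative \<open>n\<close>; the value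
    of \<open>f\<close> does not depend on the choice.\<close>
  have "factorization_count_values x \<subseteq>
      (\<lambda>E. num_unordered_factorizations (SOME n. n \<in> V \<and> exponents n = E)) ` exponents ` V"
  proof
    fix v assume "v \<in> factorization_count_values x"
    then obtain n where n: "n \<in> V" "v = num_unordered_factorizations n"
      by (auto simp: factorization_count_values_def V_def)
    define m where "m = (SOME m. m \<in> V \<and> exponents m = exponents n)"
    have "m \<in> V \<and> exponents m = exponents n"
      unfolding m_def by (rule someI[of _ n]) (simp add: n)
    then have "v = num_unordered_factorizations m"
      using n num_unordered_factorizations_cong_exponents[of m n] by (simp add: V_def)
    then show "v \<in> (\<lambda>E. num_unordered_factorizations (SOME n. n \<in> V \<and> exponents n = E)) ` exponents ` V"
      using n(1) by (auto simp: m_def)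
  qed
  then have "card (factorization_count_values x) \<le> card (exponents ` V)"
    by (rule surj_card_le[OF fin])
  also have "\<dots> \<le> card P"
    using sub card_binomial_weight_le(1)[OF assms(1-4)] by (intro card_mono) (simp_all add: P_def)
  finally have "real (card (factorization_count_values x)) \<le> real (card P)" by simp
  also note card_binomial_weight_le(2)[OF assms(1-4), folded P_def]
  finally show ?thesis .
qed

text \<open>Instantiates \<open>r\<close> as the floor of \<open>Y / L\<close>, \<open>T\<close> as
  the ceiling of \<open>\<tau>\<close> and \<open>W = 2 * Y\<close>, then removes the rounding by
  monotonicity, leaving an expression in \<open>Y\<close> alone that is ready for asymptotic
  estimates.\<close>

lemma card_factorization_count_values_le_explicit:
  fixes x :: real
  defines "Y \<equiv> ln x" and "L \<equiv> ln (ln x)"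
  defines "\<tau> \<equiv> sqrt Y * L\<^sup>2"
  defines "w \<equiv> ln ((Y / L - 1) / (\<tau> + 1))"
  assumes "x > 0" "L \<ge> 1" "\<tau> + 1 < Y / L - 1" "3 \<le> Y / L"
  shows "real (card (factorization_count_values x)) \<le>
    exp (pi * sqrt (2 / 3 * (2 * Y / w)) + 2 * Y / (\<tau> * w) * ln (Y * exp (2 * Y / (Y / L - 2)) + 1))"
proof -
  define r T where "r = nat \<lfloor>Y / L\<rfloor>" and "T = nat \<lceil>\<tau>\<rceil>"
  have "0 < Y / L" using assms(8) by simp
  then have Y: "Y > 0" using assms(6) by (simp add: zero_less_divide_iff)
  then have \<tau>: "\<tau> > 0" using assms(6) by (simp add: \<tau>_def)
  have "0 < \<lfloor>Y / L\<rfloor>" using assms(8) by linarith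
  then have r: "real r \<le> Y / L" "Y / L - 1 < real r"
    unfolding r_def by linarith+
  have T: "\<tau> \<le> real T" "real T < \<tau> + 1"
    using \<tau> unfolding T_def by linarith+
  have r2: "r \<ge> 2" using r(2) assms(8) by linarith
  have T0: "T > 0" using T(1) \<tau> by linarith
  have Tr: "T < r" using T(2) r(2) assms(7) by linarith
  have YL: "Y / L \<le> Y" using Y assms(6) by (simp add: divide_le_eq mult_le_cancel_left1)
  have rY: "real r \<le> Y" using r(1) YL by linarith
  \<comment> \<open>\<open>r \<le> Y\<close> gives \<open>ln r \<le> L\<close>, so
    \<open>r ^ r \<le> exp (Y / L * L) = x\<close>.\<close>
  have "fact r * x \<le> exp (2 * Y)"
  proof -
    have "(fact r :: real) \<le> real r ^ r" using fact_le_power[of r, where ?'a = real] by simp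
    also have "\<dots> = exp (real r * ln (real r))" unfolding exp_of_nat_mult using r2 by simp
    also have "\<dots> \<le> exp (Y / L * L)"
      using r(1) rY r2 Y assms(6) unfolding L_def Y_def[symmetric]
      by (intro iffD2[OF exp_le_cancel_iff] mult_mono) auto
    also have "Y / L * L = Y" using assms(6) by simp
    finally have "fact r * x \<le> exp Y * x" using assms(5) by (intro mult_right_mono) auto
    also have "exp Y * x = exp (2 * Y)"
      unfolding mult_2 exp_add using assms(5) by (simp add: Y_def)
    finally show ?thesis .
  qed
  from card_factorization_count_values_le[OF r2 T0 Tr _ this] Y
  have "real (card (factorization_count_values x)) \<le>
    exp (pi * sqrt (2 / 3 * (2 * Y / ln (real r / real T))) +
      2 * Y / (real T * ln (real r / real T)) * ln ((real r - 1) * exp (2 * Y / (real r - 1)) + 1))"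
    by simp
  also have "\<dots> \<le> exp (pi * sqrt (2 / 3 * (2 * Y / w)) +
      2 * Y / (\<tau> * w) * ln (Y * exp (2 * Y / (Y / L - 2)) + 1))"
  proof -
    have w: "0 < w" using assms(7) \<tau> by (simp add: w_def)
    have "(Y / L - 1) / (\<tau> + 1) \<le> real r / real T"
      using r T T0 assms(8) by (intro frac_le) auto
    moreover have "0 < (Y / L - 1) / (\<tau> + 1)" using assms(8) \<tau> by simp
    ultimately have wle: "w \<le> ln (real r / real T)" unfolding w_def by simp
    have 1: "2 * Y / ln (real r / real T) \<le> 2 * Y / w"
      using w wle Y by (intro divide_left_mono) auto
    have 2: "2 * Y / (real T * ln (real r / real T)) \<le> 2 * Y / (\<tau> * w)"
      using w wle Y T \<tau> by (intro divide_left_mono mult_mono mult_pos_pos) auto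
    have "2 * Y / (real r - 1) \<le> 2 * Y / (Y / L - 2)"
      using r(2) assms(8) Y by (intro divide_left_mono mult_pos_pos) auto
    then have 3: "(real r - 1) * exp (2 * Y / (real r - 1)) \<le> Y * exp (2 * Y / (Y / L - 2))"
      using rY r2 Y by (intro mult_mono) auto
    have 4: "0 \<le> (real r - 1) * exp (2 * Y / (real r - 1))" using r2 by simp
    have "ln ((real r - 1) * exp (2 * Y / (real r - 1)) + 1) \<le> ln (Y * exp (2 * Y / (Y / L - 2)) + 1)"
      using 3 4 by (intro ln_mono) linarith+
    moreover have "0 \<le> ln ((real r - 1) * exp (2 * Y / (real r - 1)) + 1)"
      using 4 by (intro ln_ge_zero) linarith
    ultimately show ?thesis
      unfolding exp_le_cancel_iff using 1 2 Y \<tau> w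
      by (intro add_mono mult_mono mult_left_mono real_sqrt_le_mono) auto
  qed
  finally show ?thesis .
qed

section \<open>Asymptotics\<close>

text \<open>With \<open>L = ln Y\<close> the inner logarithm is
  \<open>L / 2 - 3 * ln L + o(1)\<close>. The square root therefore has relative error about
  \<open>3 * ln L / L\<close>, and 5 leaves room.\<close>

lemma eventually_main_term_le:
  "\<forall>\<^sub>F Y :: real in at_top.
     sqrt (Y / ln ((Y / ln Y - 1) / (sqrt Y * (ln Y)\<^sup>2 + 1))) \<le>
       sqrt (2 * Y / ln Y) * (1 + 5 * (ln (ln Y) / ln Y))"
  by real_asymp

text \<open>The last logarithm is about \<open>3 * ln Y\<close>, so the left side has order
  \<open>sqrt Y / (ln Y)\<^sup>2\<close>, smaller than the right side by a factor of order
  \<open>sqrt (ln Y) * ln (ln Y)\<close>. The factor \<open>(ln Y)\<^sup>2\<close> in the threshold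
  achieves this.\<close>

lemma eventually_error_term_le:
  "\<forall>\<^sub>F Y :: real in at_top.
     2 * Y / (sqrt Y * (ln Y)\<^sup>2 * ln ((Y / ln Y - 1) / (sqrt Y * (ln Y)\<^sup>2 + 1))) *
       ln (Y * exp (2 * Y / (Y / ln Y - 2)) + 1) \<le>
     sqrt (2 * Y / ln Y) * (ln (ln Y) / ln Y)"
  by real_asymp

theorem theorem1p2:
  shows "\<exists>K x\<^sub>0 :: real. K > 0 \<and> (\<forall>x \<ge> x\<^sub>0.
    real (card (factorization_count_values x)) \<le>
      exp (2 * pi * sqrt (2 / 3) * sqrt (ln x / ln (ln x)) * (1 + K * (ln (ln (ln x)) / ln (ln x)))))"
proof -
  have "\<forall>\<^sub>F Y :: real in at_top. ln Y \<ge> 1 \<and>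
      sqrt Y * (ln Y)\<^sup>2 + 1 < Y / ln Y - 1 \<and> 3 \<le> Y / ln Y \<and> 0 \<le> ln (ln Y)"
    by (intro eventually_conj) real_asymp+
  from eventually_conj[OF this eventually_conj[OF eventually_main_term_le eventually_error_term_le]]
  \<comment> \<open>The constant 6 is 5 from the main term plus 1 from the error term. Estimates in
    \<open>Y\<close> are transferred along \<open>Y = ln x\<close>.\<close>
  have "\<forall>\<^sub>F x :: real in at_top.
    real (card (factorization_count_values x)) \<le>
      exp (2 * pi * sqrt (2 / 3) * sqrt (ln x / ln (ln x)) * (1 + 6 * (ln (ln (ln x)) / ln (ln x))))"
  proof (rule eventually_mono[OF eventually_conj[OF eventually_gt_at_top[of 0]
        eventually_compose_filterlim[OF _ ln_at_top]]])
    fix x :: real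
    define Y L \<tau> where "Y = ln x" and "L = ln (ln x)" and "\<tau> = sqrt Y * L\<^sup>2"
    define w \<rho> where "w = ln ((Y / L - 1) / (\<tau> + 1))" and "\<rho> = ln L / L"
    note defs = Y_def L_def \<tau>_def w_def \<rho>_def
    assume "0 < x \<and>
      (1 \<le> ln (ln x) \<and> sqrt (ln x) * (ln (ln x))\<^sup>2 + 1 < ln x / ln (ln x) - 1 \<and>
        3 \<le> ln x / ln (ln x) \<and> 0 \<le> ln (ln (ln x))) \<and>
      sqrt (ln x / ln ((ln x / ln (ln x) - 1) / (sqrt (ln x) * (ln (ln x))\<^sup>2 + 1))) \<le>
        sqrt (2 * ln x / ln (ln x)) * (1 + 5 * (ln (ln (ln x)) / ln (ln x))) \<and>
      2 * ln x / (sqrt (ln x) * (ln (ln x))\<^sup>2 *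
          ln ((ln x / ln (ln x) - 1) / (sqrt (ln x) * (ln (ln x))\<^sup>2 + 1))) *
        ln (ln x * exp (2 * ln x / (ln x / ln (ln x) - 2)) + 1) \<le>
        sqrt (2 * ln x / ln (ln x)) * (ln (ln (ln x)) / ln (ln x))"
    then have *: "0 < x" "1 \<le> L" "\<tau> + 1 < Y / L - 1" "3 \<le> Y / L" "0 \<le> ln L"
      and main: "sqrt (Y / w) \<le> sqrt (2 * Y / L) * (1 + 5 * \<rho>)"
      and err: "2 * Y / (\<tau> * w) * ln (Y * exp (2 * Y / (Y / L - 2)) + 1) \<le> sqrt (2 * Y / L) * \<rho>"
      unfolding defs by auto
    have \<rho>: "0 \<le> \<rho>" using * by (simp add: \<rho>_def)
    define c where "c = 2 * pi * sqrt (2 / 3)"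
    \<comment> \<open>One \<open>sqrt 2\<close> comes from \<open>W = 2 * Y\<close>, the other from
      \<open>w\<close> being about \<open>L / 2\<close>.\<close>
    have "sqrt (2 / 3) * sqrt 2 * sqrt 2 = 2 * sqrt (2 / 3)" by (simp add: mult.assoc)
    then have c: "pi * (sqrt (2 / 3) * sqrt 2) * sqrt 2 = c" by (simp add: c_def mult.assoc)
    have "pi * sqrt (2 / 3 * (2 * Y / w)) = pi * (sqrt (2 / 3) * sqrt 2) * sqrt (Y / w)"
      by (simp add: mult.assoc flip: real_sqrt_mult)
    also have "\<dots> \<le> pi * (sqrt (2 / 3) * sqrt 2) * (sqrt (2 * Y / L) * (1 + 5 * \<rho>))"
      by (intro mult_left_mono main) simp
    also have "sqrt (2 * Y / L) = sqrt 2 * sqrt (Y / L)" by (simp flip: real_sqrt_mult)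
    also have "pi * (sqrt (2 / 3) * sqrt 2) * (sqrt 2 * sqrt (Y / L) * (1 + 5 * \<rho>)) =
        c * sqrt (Y / L) * (1 + 5 * \<rho>)"
      by (subst c[symmetric]) (simp only: mult_ac)
    finally have main': "pi * sqrt (2 / 3 * (2 * Y / w)) \<le> c * sqrt (Y / L) * (1 + 5 * \<rho>)" .
    \<comment> \<open>Lets the error term, scaled by \<open>sqrt (2 * Y / L)\<close>, be absorbed as
      one more multiple of \<open>c * sqrt (Y / L) * \<rho>\<close>.\<close>
    have "sqrt 2 \<le> c"
    proof -
      have "sqrt 2 = sqrt 3 * sqrt (2 / 3)" by (simp flip: real_sqrt_mult)
      also have "\<dots> \<le> 2 * pi * sqrt (2 / 3)"
        using pi_ge_two real_sqrt_le_mono[of 3 4] by (intro mult_right_mono) auto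
      finally show ?thesis by (simp add: c_def)
    qed
    then have "sqrt 2 * sqrt (Y / L) * \<rho> \<le> c * sqrt (Y / L) * \<rho>"
      using \<rho> * by (intro mult_right_mono) auto
    then have "sqrt (2 * Y / L) * \<rho> \<le> c * sqrt (Y / L) * \<rho>" by (simp flip: real_sqrt_mult)
    with main' err have "pi * sqrt (2 / 3 * (2 * Y / w)) +
        2 * Y / (\<tau> * w) * ln (Y * exp (2 * Y / (Y / L - 2)) + 1) \<le> c * sqrt (Y / L) * (1 + 6 * \<rho>)"
      by (simp add: algebra_simps)
    then have "exp (pi * sqrt (2 / 3 * (2 * Y / w)) +
        2 * Y / (\<tau> * w) * ln (Y * exp (2 * Y / (Y / L - 2)) + 1)) \<le>
        exp (c * sqrt (Y / L) * (1 + 6 * \<rho>))" unfolding exp_le_cancel_iff .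
    with card_factorization_count_values_le_explicit[of x, folded L_def, folded Y_def, folded \<tau>_def, folded w_def, OF *(1-4)]
    have "real (card (factorization_count_values x)) \<le> exp (c * sqrt (Y / L) * (1 + 6 * \<rho>))"
      by (rule order.trans)
    then show "real (card (factorization_count_values x)) \<le>
        exp (2 * pi * sqrt (2 / 3) * sqrt (ln x / ln (ln x)) * (1 + 6 * (ln (ln (ln x)) / ln (ln x))))"
      unfolding c_def defs .
  qed
  then obtain x\<^sub>0 :: real where "\<forall>x \<ge> x\<^sub>0. real (card (factorization_count_values x)) \<le>
      exp (2 * pi * sqrt (2 / 3) * sqrt (ln x / ln (ln x)) * (1 + 6 * (ln (ln (ln x)) / ln (ln x))))"
    unfolding eventually_at_top_linorder by blast
  then show ?thesis by (intro exI[of _ 6] exI[of _ x\<^sub>0]) simp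
qed

end
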